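(* Let $n\ge 3$ be an integer and let $D_{2^n}$ be the dihedral group of order $2^n$. Then $$\operatorname{cdeg}(D_{2^n})=\frac{2^{n-1}+n}{2^n+n-1}.$$
   Context: For a finite group $G$, let $L(G)$ be the set of all subgroups of $G$ and $C(G)$ the set of all cyclic subgroups of $G$. The cyclicity degree of $G$ is $\operatorname{cdeg}(G)=|C(G)|/|L(G)|$. *)

theory Defs
  imports "HOL-Algebra.Algebra"
begin

definition subgroups :: "('a, 'b) monoid_scheme \<Rightarrow> 'a set set"
  where "subgroups G = {H. subgroup H G}"

definition cyclic_subgroups :: "('a, 'b) monoid_scheme \<Rightarrow> 'a set set"
  where "cyclic_subgroups G = {H \<in> subgroups G. cyclic_group (G\<lparr>carrier := H\<rparr>)}"

(* Meaningful for finite G only: card is 0 on infinite sets. *)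
definition cdeg :: "('a, 'b) monoid_scheme \<Rightarrow> real"
  where "cdeg G = real (card (cyclic_subgroups G)) / real (card (subgroups G))"

(* The dihedral group of order 2 * m (not m): the semidirect product of Z/m with a group of
   order 2 acting by inversion.  The pair (a, s) stands for x^a y^s, where x is a rotation of
   order m, y a reflection, and y x y = x^(-1); so (a, True) are the reflections.
   For m = 0 this is the infinite dihedral group. *)
definition dihedral_group :: "nat \<Rightarrow> (int \<times> bool) monoid"
  where "dihedral_group m =
    \<lparr>carrier = carrier (integer_mod_group m) \<times> UNIV,
     monoid.mult = (\<lambda>(a, s) (b, t). ((if s then a - b else a + b) mod int m, s \<noteq> t)),
     one = (0, False)\<rparr>"

lemma group_dihedral_group: "group (dihedral_group m)"
proof (rule groupI)
  fix x assume x: "x \<in> carrier (dihedral_group m)"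
  obtain a s where as: "x = (a, s)" by (cases x)
  show "\<exists>y\<in>carrier (dihedral_group m). y \<otimes>\<^bsub>dihedral_group m\<^esub> x = \<one>\<^bsub>dihedral_group m\<^esub>"
    by (rule bexI[of _ "((if s then a else - a) mod int m, s)"])
      (use x as in \<open>auto simp: dihedral_group_def carrier_integer_mod_group mod_simps\<close>)
qed (auto simp: dihedral_group_def carrier_integer_mod_group mod_simps algebra_simps split: if_splits)

lemma order_dihedral_group: "m > 0 \<Longrightarrow> order (dihedral_group m) = 2 * m"
  by (simp add: order_def dihedral_group_def carrier_integer_mod_group card_cartesian_product)

lemma pow_rotation_dihedral_group:
  "(1 mod int m, False) [^]\<^bsub>dihedral_group m\<^esub> (k :: nat) = (int k mod int m, False)"
  by (induction k) (auto simp: dihedral_group_def nat_pow_def mod_simps add.commute)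

lemma dihedral_group_relations:
  fixes m :: nat
  defines "D \<equiv> dihedral_group m" and "x \<equiv> (1 mod int m, False)" and "y \<equiv> (0, True)"
  assumes "m > 0"
  shows "x [^]\<^bsub>D\<^esub> m = \<one>\<^bsub>D\<^esub>" "y \<otimes>\<^bsub>D\<^esub> y = \<one>\<^bsub>D\<^esub>" "y \<otimes>\<^bsub>D\<^esub> x \<otimes>\<^bsub>D\<^esub> y = inv\<^bsub>D\<^esub> x"
    and "generate D {x, y} = carrier D"
proof -
  interpret D: group D by (simp add: D_def group_dihedral_group)
  have xy: "x \<in> carrier D" "y \<in> carrier D"
    using assms(4) by (auto simp: D_def x_def y_def dihedral_group_def carrier_integer_mod_group)
  show "x [^]\<^bsub>D\<^esub> m = \<one>\<^bsub>D\<^esub>"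
    using pow_rotation_dihedral_group[of m m] by (simp add: D_def x_def dihedral_group_def)
  show "y \<otimes>\<^bsub>D\<^esub> y = \<one>\<^bsub>D\<^esub>"
    by (simp add: D_def y_def dihedral_group_def)
  show "y \<otimes>\<^bsub>D\<^esub> x \<otimes>\<^bsub>D\<^esub> y = inv\<^bsub>D\<^esub> x"
    by (rule D.inv_equality[symmetric])
      (use xy assms(4) in \<open>auto simp: D_def x_def y_def dihedral_group_def carrier_integer_mod_group mod_simps\<close>)
  show "generate D {x, y} = carrier D"
  proof
    show "generate D {x, y} \<subseteq> carrier D"
      using xy by (intro D.generate_incl) auto
  next
    show "carrier D \<subseteq> generate D {x, y}"
    proof
      fix z assume z: "z \<in> carrier D"
      obtain a s where as: "z = (a, s)" by (cases z)
      have a: "0 \<le> a" "a < int m"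
        using z as assms(4) by (auto simp: D_def dihedral_group_def carrier_integer_mod_group)
      interpret S: subgroup "generate D {x, y}" D
        using xy by (intro D.generate_is_subgroup) auto
      have "x [^]\<^bsub>D\<^esub> k \<in> generate D {x, y}" for k :: nat
        by (induction k) (auto intro: generate.intros)
      then have r: "(a, False) \<in> generate D {x, y}"
        using pow_rotation_dihedral_group[of m "nat a"] a
        by (metis D_def x_def int_nat_eq mod_pos_pos_trivial)
      have "(a, True) = (a, False) \<otimes>\<^bsub>D\<^esub> y"
        using a by (simp add: D_def y_def dihedral_group_def)
      then have "(a, True) \<in> generate D {x, y}"
        using r by (auto intro: generate.intros)
      with r as show "z \<in> generate D {x, y}" by (cases s) auto
    qed
  qed
qed

end

(* Intersecting a subgroup H of D_m with the rotations gives the multiples of a divisor d of m.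
   If H contains a reflection (b, True), its reflections are exactly the (a, True) with
   a = b mod d.  So the subgroups are indexed by the divisors d of m together with the pairs
   (d, r) with d dividing m and 0 <= r < d.  A reflection has order 2, whence the cyclic
   subgroups are those of the first kind and the pairs with d = m. *)
theory Submission
  imports Defs
begin

section \<open>Subgroups of the integers, and cyclicity of a subgroup\<close>

text \<open>Division with remainder by the least positive element \<open>d\<close>: the remainder of
  any element of \<open>A\<close> lies in \<open>A\<close> and is below \<open>d\<close>, hence is
  zero. Membership of \<open>m\<close> guarantees that a positive element exists, so
  \<open>A\<close> is not the zero subgroup.\<close>

lemma int_additive_subgroup_eq_multiples:
  fixes A :: "int set"
  assumes diff: "\<And>a b. a \<in> A \<Longrightarrow> b \<in> A \<Longrightarrow> a - b \<in> A"
    and m: "int m \<in> A" "m > 0"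
  obtains d :: nat where "d > 0" "A = {a. int d dvd a}"
proof -
  define d where "d = (LEAST d. d > 0 \<and> int d \<in> A)"
  have d: "d > 0" "int d \<in> A"
    using LeastI[of "\<lambda>d. d > 0 \<and> int d \<in> A" m] m unfolding d_def by auto
  have least: "d \<le> e" if "e > 0" "int e \<in> A" for e
    unfolding d_def using that by (intro Least_le) auto
  have zero: "0 \<in> A" using diff[OF d(2) d(2)] by simp
  have neg: "- a \<in> A" if "a \<in> A" for a using diff[OF zero that] by simp
  have add: "a + b \<in> A" if "a \<in> A" "b \<in> A" for a b
    using diff[OF that(1) neg[OF that(2)]] by simp
  have mult_nat: "int d * int k \<in> A" for k
  proof (induction k)
    case (Suc k)
    from add[OF d(2) Suc] show ?case by (simp add: algebra_simps)
  qed (simp add: zero)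
  have mult: "int d * k \<in> A" for k
    using mult_nat[of "nat k"] neg[OF mult_nat[of "nat (- k)"]] by (cases "k \<ge> 0") simp_all
  have "int d dvd a" if "a \<in> A" for a
  proof (rule ccontr)
    assume "\<not> int d dvd a"
    then have "a mod int d \<noteq> 0" by (simp add: mod_eq_0_iff_dvd)
    moreover have "a mod int d \<ge> 0" "a mod int d < int d" using d(1) by simp_all
    ultimately have pos: "a mod int d > 0" "a mod int d < int d" by linarith+
    have "a mod int d \<in> A"
      using diff[OF that mult[of "a div int d"]] by (simp add: minus_mult_div_eq_mod)
    then show False using least[of "nat (a mod int d)"] pos by simp
  qed
  then have "A = {a. int d dvd a}" using mult by auto
  with d(1) show ?thesis by (rule that)
qed

text \<open>Generation from an element of \<open>H\<close> gives the same set in \<open>H\<close> as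
  in \<open>G\<close>, so a generator can be sought with \<open>generate G\<close> and the structure
  with restricted carrier disappears.\<close>

lemma (in group) cyclic_subgroup_iff:
  assumes "subgroup H G"
  shows "cyclic_group (G\<lparr>carrier := H\<rparr>) \<longleftrightarrow> (\<exists>x\<in>H. H = generate G {x})"
proof -
  have "subgroup_generated (G\<lparr>carrier := H\<rparr>) {x} = G\<lparr>carrier := H\<rparr> \<longleftrightarrow> H = generate G {x}"
    if "x \<in> H" for x
  proof -
    have "subgroup_generated (G\<lparr>carrier := H\<rparr>) {x} = G\<lparr>carrier := generate G {x}\<rparr>"
      using that generate_consistent[of "{x}" H] assms by (simp add: subgroup_generated_def)
    then show ?thesis by (metis partial_object.select_convs(1) partial_object.surjective
          partial_object.update_convs(1))
  qed
  then show ?thesis by (auto simp: cyclic_group_def)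
qed

section \<open>Arithmetic in the dihedral group and its two families of subgroups\<close>

lemma
  shows mult_dihedral_group:
    "(a, s) \<otimes>\<^bsub>dihedral_group m\<^esub> (b, t) = ((if s then a - b else a + b) mod int m, s \<noteq> t)"
    and one_dihedral_group: "\<one>\<^bsub>dihedral_group m\<^esub> = (0, False)"
    and carrier_dihedral_group:
      "m > 0 \<Longrightarrow> (a, s) \<in> carrier (dihedral_group m) \<longleftrightarrow> 0 \<le> a \<and> a < int m"
  by (auto simp: dihedral_group_def carrier_integer_mod_group)

lemma inv_dihedral_group:
  assumes "m > 0" "(a, s) \<in> carrier (dihedral_group m)"
  shows "inv\<^bsub>dihedral_group m\<^esub> (a, s) = ((if s then a else - a) mod int m, s)"
  by (rule group.inv_equality[OF group_dihedral_group])
    (use assms in \<open>auto simp: mult_dihedral_group one_dihedral_group carrier_dihedral_group mod_simps\<close>)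

text \<open>For \<open>d\<close> dividing \<open>m\<close> this is the cyclic group generated by
  x^d, of order m/d; \<open>d = m\<close> gives the trivial subgroup and \<open>d = 1\<close> all
  rotations.\<close>

definition rotation_subgroup :: "nat \<Rightarrow> nat \<Rightarrow> (int \<times> bool) set"
  where "rotation_subgroup m d = {(a, s). 0 \<le> a \<and> a < int m \<and> \<not> s \<and> int d dvd a}"

text \<open>For \<open>d\<close> dividing \<open>m\<close> this is the subgroup generated by x^d and
  x^r y, of order 2m/d. Only the residue of \<open>r\<close> modulo \<open>d\<close> matters, which
  is why \<open>r < d\<close> is imposed where the subgroups are listed.\<close>

definition reflection_subgroup :: "nat \<Rightarrow> nat \<Rightarrow> nat \<Rightarrow> (int \<times> bool) set"
  where "reflection_subgroup m d r =
    {(a, s). 0 \<le> a \<and> a < int m \<and> int d dvd (if s then a - int r else a)}"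

text \<open>Since \<open>d\<close> divides \<open>m\<close>, reduction modulo \<open>m\<close> does
  not affect divisibility by \<open>d\<close>, so closure can be checked on unreduced
  integers.\<close>

lemma subgroup_rotation_subgroup:
  assumes "m > 0" "d dvd m"
  shows "subgroup (rotation_subgroup m d) (dihedral_group m)"
proof (rule group.subgroupI[OF group_dihedral_group])
  have mod_iff: "int d dvd x mod int m \<longleftrightarrow> int d dvd x" for x
    using assms(2) by (simp add: dvd_mod_iff)
  show "rotation_subgroup m d \<subseteq> carrier (dihedral_group m)"
    using assms by (auto simp: rotation_subgroup_def carrier_dihedral_group)
  have "(0, False) \<in> rotation_subgroup m d"
    using assms by (simp add: rotation_subgroup_def)
  then show "rotation_subgroup m d \<noteq> {}" by blast
  show "inv\<^bsub>dihedral_group m\<^esub> x \<in> rotation_subgroup m d"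
    if "x \<in> rotation_subgroup m d" for x
    using that assms
    by (cases x) (simp add: rotation_subgroup_def carrier_dihedral_group inv_dihedral_group mod_iff)
  show "x \<otimes>\<^bsub>dihedral_group m\<^esub> y \<in> rotation_subgroup m d"
    if "x \<in> rotation_subgroup m d" "y \<in> rotation_subgroup m d" for x y
    using that assms
    by (cases x; cases y) (simp add: rotation_subgroup_def mult_dihedral_group mod_iff)
qed

lemma subgroup_reflection_subgroup:
  assumes "m > 0" "d dvd m"
  shows "subgroup (reflection_subgroup m d r) (dihedral_group m)"
proof (rule group.subgroupI[OF group_dihedral_group])
  have mod_iff: "int d dvd x mod int m - y \<longleftrightarrow> int d dvd x - y" for x y
    using assms(2) by (metis dvd_mod_iff mod_diff_left_eq of_nat_dvd_iff)
  have mod_iff0: "int d dvd x mod int m \<longleftrightarrow> int d dvd x" for x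
    using mod_iff[of x 0] by simp
  show "reflection_subgroup m d r \<subseteq> carrier (dihedral_group m)"
    using assms by (auto simp: reflection_subgroup_def carrier_dihedral_group)
  have "(0, False) \<in> reflection_subgroup m d r"
    using assms by (auto simp: reflection_subgroup_def)
  then show "reflection_subgroup m d r \<noteq> {}" by blast
  show "inv\<^bsub>dihedral_group m\<^esub> x \<in> reflection_subgroup m d r"
    if "x \<in> reflection_subgroup m d r" for x
    using that assms
    by (cases x) (auto simp: reflection_subgroup_def carrier_dihedral_group inv_dihedral_group
        mod_iff mod_iff0 split: if_splits)
  show "x \<otimes>\<^bsub>dihedral_group m\<^esub> y \<in> reflection_subgroup m d r"
    if xy: "x \<in> reflection_subgroup m d r" "y \<in> reflection_subgroup m d r" for x y
  proof -
    obtain a s b t where [simp]: "x = (a, s)" "y = (b, t)" by (cases x, cases y)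
    have a: "int d dvd (if s then a - int r else a)" and b: "int d dvd (if t then b - int r else b)"
      using xy by (auto simp: reflection_subgroup_def)
    have "int d dvd (if s \<noteq> t then (if s then a - b else a + b) - int r
        else (if s then a - b else a + b))"
      using dvd_diff[OF a b] dvd_add[OF a b] by (auto simp: algebra_simps split: if_splits)
    then show ?thesis
      using assms
      by (simp add: reflection_subgroup_def mult_dihedral_group mod_iff mod_iff0 split: if_splits)
  qed
qed

lemma subgroup_dihedral_group_cases:
  assumes "m > 0" "subgroup H (dihedral_group m)"
  obtains d where "d dvd m" "H = rotation_subgroup m d"
  | d r where "d dvd m" "r < d" "H = reflection_subgroup m d r"
proof -
  interpret H: subgroup H "dihedral_group m" by fact
  have carrier: "0 \<le> a \<and> a < int m" if "(a, s) \<in> H" for a s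
    using H.mem_carrier[OF that] assms(1) by (simp add: carrier_dihedral_group)
  define A where "A = {a. (a mod int m, False) \<in> H}"
  have "a - b \<in> A" if "a \<in> A" "b \<in> A" for a b
  proof -
    have "(a mod int m, False) \<otimes>\<^bsub>dihedral_group m\<^esub> inv\<^bsub>dihedral_group m\<^esub> (b mod int m, False) \<in> H"
      using that by (auto simp: A_def)
    then show ?thesis
      using assms(1)
      by (simp add: A_def inv_dihedral_group carrier_dihedral_group mult_dihedral_group mod_simps)
  qed
  moreover have mA: "int m \<in> A"
    using H.one_closed by (simp add: A_def one_dihedral_group)
  ultimately obtain d where d: "d > 0" "A = {a. int d dvd a}"
    using int_additive_subgroup_eq_multiples[of A m] assms(1) by blast
  have dvd: "d dvd m" using mA d(2) by simp
  have rot: "(a, False) \<in> H \<longleftrightarrow> 0 \<le> a \<and> a < int m \<and> int d dvd a" for a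
  proof (cases "0 \<le> a \<and> a < int m")
    case True
    then have "(a, False) \<in> H \<longleftrightarrow> a \<in> A" by (simp add: A_def)
    with True d(2) show ?thesis by simp
  qed (use carrier in blast)
  show ?thesis
  proof (cases "\<exists>b. (b, True) \<in> H")
    case False
    then have "H = rotation_subgroup m d"
      by (auto simp: rotation_subgroup_def rot split_paired_all) (metis (full_types) rot)+
    with dvd show ?thesis by (rule that(1))
  next
    case True
    then obtain b where b: "(b, True) \<in> H" by blast
    have mod_iff: "int d dvd x mod int m \<longleftrightarrow> int d dvd x" for x
      using dvd by (simp add: dvd_mod_iff)
    have refl: "(a, True) \<in> H \<longleftrightarrow> 0 \<le> a \<and> a < int m \<and> int d dvd a - b" for a
    proof
      assume a: "(a, True) \<in> H"
      have "((a - b) mod int m, False) \<in> H"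
        using H.m_closed[OF a b] by (simp add: mult_dihedral_group)
      with carrier[OF a] show "0 \<le> a \<and> a < int m \<and> int d dvd a - b"
        by (simp add: rot mod_iff)
    next
      assume a: "0 \<le> a \<and> a < int m \<and> int d dvd a - b"
      then have "((a - b) mod int m, False) \<in> H"
        using assms(1) by (simp add: rot mod_iff)
      from H.m_closed[OF this b] a show "(a, True) \<in> H"
        by (simp add: mult_dihedral_group mod_simps)
    qed
    define r where "r = nat (b mod int d)"
    have r: "int r = b mod int d" "r < d" using d(1) by (auto simp: r_def nat_less_iff)
    have "int d dvd a - b \<longleftrightarrow> int d dvd a - int r" for a
      by (simp add: r mod_eq_dvd_iff[symmetric])
    then have "(a, s) \<in> H \<longleftrightarrow> (a, s) \<in> reflection_subgroup m d r" for a s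
      by (cases s) (simp_all add: reflection_subgroup_def rot refl)
    then have "H = reflection_subgroup m d r" by (auto simp: set_eq_iff)
    with dvd r(2) show ?thesis by (rule that(2))
  qed
qed

lemma reflection_in_reflection_subgroup:
  "\<lbrakk>m > 0; d dvd m; r < d\<rbrakk> \<Longrightarrow> (int r, True) \<in> reflection_subgroup m d r"
  using dvd_imp_le[of d m] by (auto simp: reflection_subgroup_def)

lemma generate_reflection:
  assumes "r < m"
  shows "generate (dihedral_group m) {(int r, True)} = reflection_subgroup m m r"
proof
  have m: "m > 0" using assms by simp
  show "generate (dihedral_group m) {(int r, True)} \<subseteq> reflection_subgroup m m r"
    using group.generate_subgroup_incl[OF group_dihedral_group _
        subgroup_reflection_subgroup[OF m dvd_refl]]
      reflection_in_reflection_subgroup[OF m dvd_refl assms] by simp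
  show "reflection_subgroup m m r \<subseteq> generate (dihedral_group m) {(int r, True)}"
  proof
    fix x assume "x \<in> reflection_subgroup m m r"
    then obtain a s where x: "x = (a, s)" "0 \<le> a" "a < int m"
      "int m dvd (if s then a - int r else a)"
      by (auto simp: reflection_subgroup_def)
    have "a = (if s then int r else 0)"
    proof (cases s)
      case True
      then have "a mod int m = int r mod int m" using x(4) by (simp only: mod_eq_dvd_iff if_True)
      with x(2,3) assms True show ?thesis
        by (metis mod_pos_pos_trivial of_nat_0_le_iff of_nat_less_iff)
    next
      case False
      then show ?thesis using x zdvd_imp_le[of "int m" a] by fastforce
    qed
    then show "x \<in> generate (dihedral_group m) {(int r, True)}"
      using generate.one[of "dihedral_group m" "{(int r, True)}"]
      by (auto simp: x(1) one_dihedral_group intro: generate.incl)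
  qed
qed

lemma generate_rotation:
  assumes "m > 0" "d dvd m"
  shows "generate (dihedral_group m) {(int d mod int m, False)} = rotation_subgroup m d"
proof
  have "(int d mod int m, False) \<in> rotation_subgroup m d"
    using assms by (auto simp: rotation_subgroup_def dvd_mod_iff)
  then show "generate (dihedral_group m) {(int d mod int m, False)} \<subseteq> rotation_subgroup m d"
    using group.generate_subgroup_incl[OF group_dihedral_group _
        subgroup_rotation_subgroup[OF assms]] by simp
  have multiples: "(int d * int k mod int m, False)
      \<in> generate (dihedral_group m) {(int d mod int m, False)}" for k
  proof (induction k)
    case 0
    then show ?case using generate.one[of "dihedral_group m"] by (simp add: one_dihedral_group)
  next
    case (Suc k)
    from generate.eng[OF generate.incl Suc] show ?case
      by (simp add: mult_dihedral_group mod_simps algebra_simps)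
  qed
  show "rotation_subgroup m d \<subseteq> generate (dihedral_group m) {(int d mod int m, False)}"
  proof
    fix x assume "x \<in> rotation_subgroup m d"
    then obtain a where x: "x = (a, False)" "0 \<le> a" "a < int m" "int d dvd a"
      by (auto simp: rotation_subgroup_def)
    then obtain k where "nat a = d * k" by (metis dvd_def int_dvd_int_iff nat_0_le)
    then have "a = int d * int k" using x(2) by (metis int_nat_eq of_nat_mult)
    then show "x \<in> generate (dihedral_group m) {(int d mod int m, False)}"
      using multiples[of k] x by simp
  qed
qed

lemma subgroups_dihedral_group:
  assumes "m > 0"
  shows "subgroups (dihedral_group m) = rotation_subgroup m ` {d. d dvd m} \<union>
    (\<lambda>(d, r). reflection_subgroup m d r) ` (SIGMA d:{d. d dvd m}. {..<d})"
proof (intro Set.set_eqI iffI)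
  fix H assume "H \<in> subgroups (dihedral_group m)"
  then have "subgroup H (dihedral_group m)" by (simp add: subgroups_def)
  with assms show "H \<in> rotation_subgroup m ` {d. d dvd m} \<union>
    (\<lambda>(d, r). reflection_subgroup m d r) ` (SIGMA d:{d. d dvd m}. {..<d})"
    by (cases rule: subgroup_dihedral_group_cases) force+
qed (use assms in \<open>auto simp: subgroups_def subgroup_rotation_subgroup subgroup_reflection_subgroup\<close>)

lemma cyclic_subgroups_dihedral_group:
  assumes "m > 0"
  shows "cyclic_subgroups (dihedral_group m) =
    rotation_subgroup m ` {d. d dvd m} \<union> reflection_subgroup m m ` {..<m}"
proof (intro Set.set_eqI iffI)
  fix H assume "H \<in> cyclic_subgroups (dihedral_group m)"
  then have sub: "subgroup H (dihedral_group m)"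
    and "cyclic_group (dihedral_group m\<lparr>carrier := H\<rparr>)"
    by (auto simp: cyclic_subgroups_def subgroups_def)
  then obtain a s where x: "(a, s) \<in> H" and gen: "H = generate (dihedral_group m) {(a, s)}"
    by (auto simp: group.cyclic_subgroup_iff[OF group_dihedral_group])
  have a: "0 \<le> a" "a < int m"
    using subgroup.mem_carrier[OF sub x] assms by (auto simp: carrier_dihedral_group)
  show "H \<in> rotation_subgroup m ` {d. d dvd m} \<union> reflection_subgroup m m ` {..<m}"
  proof (cases s)
    case True
    then have "H = reflection_subgroup m m (nat a)"
      using generate_reflection[of "nat a" m] a gen by (simp add: nat_less_iff)
    then show ?thesis using a by (auto simp: nat_less_iff)
  next
    case False
    then have "(a, s) \<in> rotation_subgroup m 1" using a by (simp add: rotation_subgroup_def)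
    then have "H \<subseteq> rotation_subgroup m 1"
      unfolding gen using assms
      by (intro group.generate_subgroup_incl[OF group_dihedral_group] subgroup_rotation_subgroup)
        auto
    then have "(int r, True) \<notin> H" for r by (auto simp: rotation_subgroup_def)
    with assms sub show ?thesis
      by (cases rule: subgroup_dihedral_group_cases)
        (use reflection_in_reflection_subgroup[OF assms] in blast)+
  qed
next
  fix H assume H: "H \<in> rotation_subgroup m ` {d. d dvd m} \<union> reflection_subgroup m m ` {..<m}"
  then have sub: "H \<in> subgroups (dihedral_group m)"
    using assms by (auto simp: subgroups_dihedral_group)
  have "\<exists>x. H = generate (dihedral_group m) {x}"
    using H assms by (auto simp flip: generate_rotation generate_reflection)
  then obtain x where x: "H = generate (dihedral_group m) {x}" ..
  then have "x \<in> H" by (simp add: generate.incl)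
  with x have "\<exists>x\<in>H. H = generate (dihedral_group m) {x}" by blast
  with sub show "H \<in> cyclic_subgroups (dihedral_group m)"
    by (simp add: cyclic_subgroups_def subgroups_def
        group.cyclic_subgroup_iff[OF group_dihedral_group])
qed

lemma rotation_subgroup_eq_iff:
  assumes "m > 0" "d dvd m" "e dvd m"
  shows "rotation_subgroup m d = rotation_subgroup m e \<longleftrightarrow> d = e"
proof
  have *: "e' dvd d'" if "rotation_subgroup m d' = rotation_subgroup m e'" "d' dvd m" "e' dvd m"
    for d' e'
  proof -
    have "(int d' mod int m, False) \<in> rotation_subgroup m d'"
      using assms(1) that(2) by (simp add: rotation_subgroup_def dvd_mod_iff)
    then show ?thesis
      unfolding that(1) using that(3) by (simp add: rotation_subgroup_def dvd_mod_iff)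
  qed
  assume eq: "rotation_subgroup m d = rotation_subgroup m e"
  show "d = e"
    using *[OF eq assms(2,3)] *[OF eq[symmetric] assms(3,2)] by (simp add: dvd_antisym)
qed simp

lemma reflection_subgroup_eq_iff:
  assumes "m > 0" "d dvd m" "e dvd m" "r < d" "q < e"
  shows "reflection_subgroup m d r = reflection_subgroup m e q \<longleftrightarrow> d = e \<and> r = q"
proof
  assume eq: "reflection_subgroup m d r = reflection_subgroup m e q"
  have rot: "rotation_subgroup m d' = reflection_subgroup m d' r' \<inter> {(a, s). \<not> s}" for d' r'
    by (auto simp: reflection_subgroup_def rotation_subgroup_def)
  have "rotation_subgroup m d = rotation_subgroup m e"
    unfolding rot[of d r] rot[of e q] eq ..
  then have de: "d = e" using assms by (simp add: rotation_subgroup_eq_iff)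
  have "(int r, True) \<in> reflection_subgroup m e q"
    using reflection_in_reflection_subgroup[OF assms(1,2,4)] unfolding eq .
  then have "int r mod int e = int q mod int e"
    unfolding mod_eq_dvd_iff by (simp add: reflection_subgroup_def)
  with assms(4,5) de show "d = e \<and> r = q" by (metis mod_less of_nat_eq_iff zmod_int)
qed simp

lemma rotation_subgroup_neq_reflection_subgroup:
  assumes "m > 0" "e dvd m" "q < e"
  shows "rotation_subgroup m d \<noteq> reflection_subgroup m e q"
proof
  assume eq: "rotation_subgroup m d = reflection_subgroup m e q"
  have "(int q, True) \<in> rotation_subgroup m d"
    unfolding eq by (rule reflection_in_reflection_subgroup[OF assms])
  then show False by (simp add: rotation_subgroup_def)
qed

lemma card_subgroups_dihedral_group:
  assumes "m > 0"
  shows "card (subgroups (dihedral_group m)) = card {d. d dvd m} + \<Sum>{d. d dvd m}"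
proof -
  let ?R = "rotation_subgroup m ` {d. d dvd m}"
  let ?I = "SIGMA d:{d. d dvd m}. {..<d}"
  let ?E = "(\<lambda>(d, r). reflection_subgroup m d r) ` ?I"
  have fin: "finite {d. d dvd m}" using assms by simp
  have "inj_on (rotation_subgroup m) {d. d dvd m}"
    using assms by (simp add: inj_on_def rotation_subgroup_eq_iff)
  then have "card ?R = card {d. d dvd m}" by (rule card_image)
  moreover have "inj_on (\<lambda>(d, r). reflection_subgroup m d r) ?I"
  proof (rule inj_onI)
    fix x y assume "x \<in> ?I" "y \<in> ?I" and
      eq: "(case x of (d, r) \<Rightarrow> reflection_subgroup m d r) = (case y of (d, r) \<Rightarrow> reflection_subgroup m d r)"
    then obtain d r e q where xy: "x = (d, r)" "y = (e, q)"
      and *: "d dvd m" "e dvd m" "r < d" "q < e"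
      by (elim SigmaE) (simp only: mem_Collect_eq lessThan_iff)
    from eq have "reflection_subgroup m d r = reflection_subgroup m e q"
      by (simp only: xy prod.case)
    then show "x = y" by (simp only: xy reflection_subgroup_eq_iff[OF assms *])
  qed
  then have "card ?E = card ?I" by (rule card_image)
  moreover have "card ?I = \<Sum>{d. d dvd m}"
    using fin by simp
  moreover have "?R \<inter> ?E = {}"
  proof (rule equals0I)
    fix H assume "H \<in> ?R \<inter> ?E"
    then obtain d e q where "H = rotation_subgroup m d" "H = reflection_subgroup m e q"
      and *: "e dvd m" "q < e"
      by (elim IntE imageE SigmaE) (simp only: mem_Collect_eq lessThan_iff prod.case)
    then show False
      using rotation_subgroup_neq_reflection_subgroup[OF assms *] by metis
  qed
  then have "card (?R \<union> ?E) = card ?R + card ?E"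
    using fin by (intro card_Un_disjoint finite_imageI finite_SigmaI) simp_all
  ultimately show ?thesis
    by (simp only: subgroups_dihedral_group[OF assms])
qed

lemma card_cyclic_subgroups_dihedral_group:
  assumes "m > 0"
  shows "card (cyclic_subgroups (dihedral_group m)) = card {d. d dvd m} + m"
proof -
  let ?R = "rotation_subgroup m ` {d. d dvd m}"
  let ?E = "reflection_subgroup m m ` {..<m}"
  have fin: "finite {d. d dvd m}" using assms by simp
  have "inj_on (rotation_subgroup m) {d. d dvd m}"
    using assms by (simp add: inj_on_def rotation_subgroup_eq_iff)
  then have "card ?R = card {d. d dvd m}" by (rule card_image)
  moreover have "inj_on (reflection_subgroup m m) {..<m}"
    using assms by (simp add: inj_on_def reflection_subgroup_eq_iff)
  then have "card ?E = card {..<m}" by (rule card_image)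
  moreover have "?R \<inter> ?E = {}"
    using rotation_subgroup_neq_reflection_subgroup[OF assms dvd_refl] by fast
  then have "card (?R \<union> ?E) = card ?R + card ?E"
    using fin by (intro card_Un_disjoint finite_imageI) simp_all
  ultimately show ?thesis
    by (simp only: cyclic_subgroups_dihedral_group[OF assms] card_lessThan)
qed

theorem theorem3p3p4:
  fixes n :: nat
  assumes "n \<ge> 3"
  shows "cdeg (dihedral_group (2 ^ (n - 1))) = (2 ^ (n - 1) + real n) / (2 ^ n + real n - 1)"
proof -
  obtain k where n: "n = Suc k" using assms by (cases n) auto
  have divisors: "{d. d dvd (2::nat) ^ k} = (\<lambda>i. 2 ^ i) ` {..k}"
    by (auto simp: divides_primepow_nat le_imp_power_dvd)
  have inj: "inj_on (\<lambda>i. (2::nat) ^ i) {..k}" by (auto simp: inj_on_def)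
  have card: "card {d. d dvd (2::nat) ^ k} = Suc k"
    by (simp add: divisors card_image inj)
  have sum: "\<Sum>{d. d dvd (2::nat) ^ k} = (\<Sum>i\<le>k. 2 ^ i)"
    by (simp add: divisors sum.reindex inj)
  have "real (\<Sum>i\<le>k. 2 ^ i) = 2 ^ Suc k - 1"
    by (induction k) auto
  then have subs: "real (card (subgroups (dihedral_group (2 ^ k)))) = real (Suc k) + (2 ^ Suc k - 1)"
    by (simp only: card_subgroups_dihedral_group[OF zero_less_power[OF pos2]] card sum of_nat_add)
  have cyclic: "real (card (cyclic_subgroups (dihedral_group (2 ^ k)))) = real (Suc k) + 2 ^ k"
    by (simp only: card_cyclic_subgroups_dihedral_group[OF zero_less_power[OF pos2]] card
        of_nat_add of_nat_power of_nat_numeral)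
  show ?thesis
    by (simp only: cdeg_def n diff_Suc_1 subs cyclic) (simp add: algebra_simps)
qed

end
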